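(* Let $n\ge 1$ and $\tau\in G_{n-1}$, and put $c=2(1+\tau(X_{n-1}))^{-1}\in\mathbb{R}$. Define the real sequence $a_0=1$, $a_{2k-1}=c$, $a_{2k}=2$ for $k\ge1$, and $p_{-1}=1$, $p_0=a_0$, $q_{-1}=0$, $q_0=1$, $p_k=a_kp_{k-1}+p_{k-2}$, $q_k=a_kq_{k-1}+q_{k-2}$ for $k\ge1$. Then the convergents $p_k/q_k$ are defined and converge, and \[ \sqrt{2+\tau(X_{n-1})}=\lim_{k\to\infty}\frac{p_k}{q_k}=[1,\overline{2(1+\tau(X_{n-1}))^{-1},2}]. \]
   Context: $X_j=2\cos(2\pi/2^{j+2})$ for $j\ge0$ (so $X_0=0$, $X_j=\sqrt{2+X_{j-1}}$), $\mathbb{B}_j=\mathbb{Q}(X_j)$, $G_j=\mathrm{Gal}(\mathbb{B}_j/\mathbb{Q})$; elements $\tau\in G_{n-1}$ are viewed as real embeddings of $\mathbb{B}_{n-1}$. The notation $[a_0,a_1,\dots]$ denotes the continued fraction $a_0+\cfrac{1}{a_1+\cdots}$, i.e. the limit of $[a_0,\dots,a_k]=p_k/q_k$, and $[a_0,\overline{b_1,b_2}]$ denotes $[a_0,b_1,b_2,b_1,b_2,\dots]$. The square root is the positive one. *)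

theory Defs
  imports "HOL-Algebra.Algebraic_Closure_Type" "HOL-Algebra.Generated_Fields"
    "HOL-Algebra.Bij"
begin

abbreviation real_field :: "real ring"
  where "real_field \<equiv> ring_of_type_algebra"

definition XB :: "nat \<Rightarrow> real"
  where "XB j = 2 * cos (2 * pi / 2 ^ (j + 2))"

lemma XB_0: "XB 0 = 0"
  by (simp add: XB_def)

lemma XB_Suc: "XB (Suc j) = sqrt (2 + XB j)"
proof -
  define t :: real where "t = 2 * pi / 2 ^ (Suc j + 2)"
  have t: "0 \<le> t" "t \<le> pi / 2"
  proof -
    have "(4::real) \<le> 2 ^ (Suc j + 2)"
      using power_increasing[of 2 "Suc j + 2" "2::real"] by simp
    then have "2 * pi / 2 ^ (Suc j + 2) \<le> 2 * pi / 4"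
      by (intro divide_left_mono) auto
    then show "0 \<le> t" "t \<le> pi / 2" by (auto simp: t_def)
  qed
  have "XB j = 2 * cos (2 * t)" by (simp add: XB_def t_def)
  then have "2 + XB j = (2 * cos t)\<^sup>2"
    by (simp add: cos_double_cos power2_eq_square)
  moreover have "cos t \<ge> 0" using t by (intro cos_ge_zero) auto
  ultimately have "sqrt (2 + XB j) = 2 * cos t"
    by (intro real_sqrt_unique) auto
  then show ?thesis by (simp add: XB_def t_def)
qed

definition BF :: "nat \<Rightarrow> real set"
  where "BF j = generate_field real_field (\<rat> \<union> {XB j})"

text \<open>As for \<^const>\<open>Bij\<close>, only functions that are extensional on \<open>L\<close> are taken, so that
  distinct elements are distinct automorphisms of \<open>L\<close>.\<close>

definition Gal :: "real set \<Rightarrow> real set \<Rightarrow> (real \<Rightarrow> real) monoid"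
  where "Gal L K = BijGroup L
    \<lparr>carrier := {\<sigma> \<in> ring_iso (real_field\<lparr>carrier := L\<rparr>) (real_field\<lparr>carrier := L\<rparr>) \<inter> Bij L.
                  \<forall>x\<in>K. \<sigma> x = x}\<rparr>"

definition GB :: "nat \<Rightarrow> (real \<Rightarrow> real) monoid"
  where "GB j = Gal (BF j) \<rat>"

text \<open>\<open>cfrac_fin k a\<close> is the nested fraction \<open>[a 0, \<dots>, a k]\<close>; \<open>cfrac_defined k a\<close> says that
  no division by zero occurs when it is evaluated.\<close>

primrec cfrac_fin :: "nat \<Rightarrow> (nat \<Rightarrow> real) \<Rightarrow> real"
  where
    "cfrac_fin 0 a = a 0"
  | "cfrac_fin (Suc k) a = a 0 + 1 / cfrac_fin k (\<lambda>i. a (Suc i))"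

primrec cfrac_defined :: "nat \<Rightarrow> (nat \<Rightarrow> real) \<Rightarrow> bool"
  where
    "cfrac_defined 0 a = True"
  | "cfrac_defined (Suc k) a \<longleftrightarrow>
       cfrac_defined k (\<lambda>i. a (Suc i)) \<and> cfrac_fin k (\<lambda>i. a (Suc i)) \<noteq> 0"

text \<open>\<open>x = [a 0, a 1, \<dots>]\<close>\<close>

definition has_cfrac :: "real \<Rightarrow> (nat \<Rightarrow> real) \<Rightarrow> bool"
  where "has_cfrac x a \<longleftrightarrow>
    (\<forall>k. cfrac_defined k a) \<and> (\<lambda>k. cfrac_fin k a) \<longlonglongrightarrow> x"

text \<open>The entries of \<open>[a0, b1, b2, b1, b2, \<dots>]\<close>, with \<open>b1, b2\<close> repeating.\<close>

definition periodic2 :: "real \<Rightarrow> real \<Rightarrow> real \<Rightarrow> nat \<Rightarrow> real"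
  where "periodic2 a0 b1 b2 i = (if i = 0 then a0 else if odd i then b1 else b2)"

end

theory Submission
  imports Defs
begin

text \<open>
  The numerators and denominators of convergents are continuants. If \<open>\<alpha>\<close> and \<open>\<beta>\<close> are the roots
  of \<open>x\<^sup>2 - b x - d\<close>, the continuants of \<open>b, b/d, b, b/d, \<dots>\<close> are, up to powers of \<open>d\<close>, the Lucas
  numbers \<open>(\<alpha>\<^sup>k - \<beta>\<^sup>k) / (\<alpha> - \<beta>)\<close>. For \<open>\<bar>\<beta>\<bar> < \<bar>\<alpha>\<bar>\<close> they do not vanish, even when \<open>b/d\<close> is
  negative, and their ratios tend to \<open>\<alpha>\<close>. The roots \<open>1 \<plusminus> \<surd>(2 + t)\<close> give the theorem, after
  subtracting \<open>1\<close> from the first entry, as soon as \<open>t = \<tau>(X\<^bsub>n-1\<^esub>)\<close> satisfies \<open>t > -2\<close> and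
  \<open>t \<noteq> -1\<close>. Both follow by induction from
  \<open>\<tau>(X\<^bsub>j+1\<^esub>)\<^sup>2 = 2 + \<tau>(X\<^bsub>j\<^esub>)\<close> and \<open>X\<^bsub>0\<^esub> = 0\<close>: the interval \<open>\<bar>x\<bar> < 2\<close> is preserved under taking
  square roots of \<open>2 + x\<close>, and \<open>-1\<close> is a square root of \<open>2 + x\<close> only for \<open>x = -1\<close>.
\<close>

fun continuant :: "(nat \<Rightarrow> 'a::comm_semiring_1) \<Rightarrow> nat \<Rightarrow> 'a"
  where
    "continuant a 0 = 1"
  | "continuant a (Suc 0) = a 0"
  | "continuant a (Suc (Suc k)) = a (Suc k) * continuant a (Suc k) + continuant a k"

lemma continuant_Suc_Suc_left:
  "continuant a (Suc (Suc k))
    = a 0 * continuant (\<lambda>i. a (Suc i)) (Suc k) + continuant (\<lambda>i. a (Suc (Suc i))) k"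
proof (induction a k rule: continuant.induct)
  case (3 a k)
  have "continuant a (Suc (Suc (Suc (Suc k))))
      = a (Suc (Suc (Suc k))) * continuant a (Suc (Suc (Suc k))) + continuant a (Suc (Suc k))"
    by (rule continuant.simps(3))
  then show ?case
    unfolding "3.IH" by (simp add: algebra_simps)
qed (simp_all add: algebra_simps)

lemma continuant_eqI:
  assumes "y 0 = 1" "y 1 = a 0"
    and "\<And>k. y (Suc (Suc k)) = a (Suc k) * y (Suc k) + y k"
  shows "y k = continuant a k"
  using assms by (induction a k rule: continuant.induct) simp_all

lemma cfrac_fin_eq_continuant_ratio:
  assumes "cfrac_defined k a"
  shows "continuant (\<lambda>i. a (Suc i)) k \<noteq> 0"
    and "cfrac_fin k a = continuant a (Suc k) / continuant (\<lambda>i. a (Suc i)) k"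
proof -
  have "continuant (\<lambda>i. a (Suc i)) k \<noteq> 0
      \<and> cfrac_fin k a = continuant a (Suc k) / continuant (\<lambda>i. a (Suc i)) k"
    using assms
  proof (induction k arbitrary: a)
    case (Suc k)
    let ?b = "\<lambda>i. a (Suc i)"
    have tail: "cfrac_fin k ?b = continuant ?b (Suc k) / continuant (\<lambda>i. ?b (Suc i)) k"
      and nonzero: "continuant ?b (Suc k) \<noteq> 0"
      using Suc.IH[of ?b] Suc.prems by auto
    have "cfrac_fin (Suc k) a = a 0 + continuant (\<lambda>i. ?b (Suc i)) k / continuant ?b (Suc k)"
      by (simp add: tail)
    also have "\<dots> = continuant a (Suc (Suc k)) / continuant ?b (Suc k)"
      using nonzero by (simp only: continuant_Suc_Suc_left add_divide_distrib) simp
    finally show ?case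
      using nonzero by blast
  qed simp
  then show "continuant (\<lambda>i. a (Suc i)) k \<noteq> 0"
    and "cfrac_fin k a = continuant a (Suc k) / continuant (\<lambda>i. a (Suc i)) k"
    by blast+
qed

lemma cfrac_definedI:
  assumes "\<And>r j. 0 < r \<Longrightarrow> continuant (\<lambda>i. a (r + i)) j \<noteq> 0"
  shows "cfrac_defined k a"
  using assms
proof (induction k arbitrary: a)
  case (Suc k)
  let ?b = "\<lambda>i. a (Suc i)"
  have defined: "cfrac_defined k ?b"
    using Suc.prems[of "Suc r" for r] by (intro Suc.IH) simp
  moreover have "continuant ?b (Suc k) \<noteq> 0"
    using Suc.prems[of 1 "Suc k"] by simp
  ultimately show ?case
    using cfrac_fin_eq_continuant_ratio[OF defined] by simp
qed simp

lemma has_cfrac_imp_convergents: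
  fixes p q :: "int \<Rightarrow> real"
  assumes cfrac: "has_cfrac x a"
    and p: "p (-1) = 1" "p 0 = a 0" and q: "q (-1) = 0" "q 0 = 1"
    and p_rec: "\<And>k::nat. k \<ge> 1 \<Longrightarrow> p (int k) = a k * p (int k - 1) + p (int k - 2)"
    and q_rec: "\<And>k::nat. k \<ge> 1 \<Longrightarrow> q (int k) = a k * q (int k - 1) + q (int k - 2)"
  shows "q (int k) \<noteq> 0" and "(\<lambda>k. p (int k) / q (int k)) \<longlonglongrightarrow> x"
proof -
  have numerator: "p (int k) = continuant a (Suc k)" for k
    using continuant_eqI[of "\<lambda>k. p (int k - 1)" a "Suc k"] p p_rec[of "Suc k" for k]
    by simp
  have denominator: "q (int k) = continuant (\<lambda>i. a (Suc i)) k" for k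
    using q q_rec[of 1] q_rec[of "Suc (Suc k)" for k]
    by (intro continuant_eqI[of "\<lambda>k. q (int k)"]) simp_all
  have defined: "cfrac_defined k a" for k
    using cfrac by (simp add: has_cfrac_def)
  show "q (int k) \<noteq> 0"
    unfolding denominator by (rule cfrac_fin_eq_continuant_ratio(1)[OF defined])
  show "(\<lambda>k. p (int k) / q (int k)) \<longlonglongrightarrow> x"
    using cfrac
    by (simp add: numerator denominator has_cfrac_def cfrac_fin_eq_continuant_ratio(2)[OF defined])
qed

lemma has_cfrac_add_first:
  assumes "has_cfrac x a"
  shows "has_cfrac (x + y) (a(0 := a 0 + y))"
proof -
  have "cfrac_defined k (a(0 := a 0 + y)) = cfrac_defined k a"
    and "cfrac_fin k (a(0 := a 0 + y)) = cfrac_fin k a + y" for k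
    by (cases k; simp)+
  then show ?thesis
    using assms by (auto simp: has_cfrac_def intro: tendsto_add)
qed

definition lucas_seq :: "'a::field \<Rightarrow> 'a \<Rightarrow> nat \<Rightarrow> 'a"
  where "lucas_seq \<alpha> \<beta> n = (\<alpha> ^ n - \<beta> ^ n) / (\<alpha> - \<beta>)"

lemma lucas_seq_0: "lucas_seq \<alpha> \<beta> 0 = 0"
  by (simp add: lucas_seq_def)

lemma lucas_seq_1:
  assumes "\<alpha> \<noteq> \<beta>"
  shows "lucas_seq \<alpha> \<beta> (Suc 0) = 1"
  using assms by (simp add: lucas_seq_def)

lemma lucas_seq_Suc_Suc:
  "lucas_seq \<alpha> \<beta> (Suc (Suc n)) = (\<alpha> + \<beta>) * lucas_seq \<alpha> \<beta> (Suc n) - \<alpha> * \<beta> * lucas_seq \<alpha> \<beta> n"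
proof -
  have "\<alpha> ^ Suc (Suc n) - \<beta> ^ Suc (Suc n)
      = (\<alpha> + \<beta>) * (\<alpha> ^ Suc n - \<beta> ^ Suc n) - \<alpha> * \<beta> * (\<alpha> ^ n - \<beta> ^ n)"
    by (simp add: algebra_simps)
  then show ?thesis
    unfolding lucas_seq_def times_divide_eq_right by (simp only: diff_divide_distrib[symmetric])
qed

lemma lucas_seq_nonzero:
  fixes \<alpha> \<beta> :: "'a::real_normed_field"
  assumes "norm \<beta> < norm \<alpha>" "0 < n"
  shows "lucas_seq \<alpha> \<beta> n \<noteq> 0"
proof -
  have "norm (\<beta> ^ n) < norm (\<alpha> ^ n)"
    using assms by (simp add: norm_power power_strict_mono)
  then show ?thesis
    using assms(1) by (auto simp: lucas_seq_def)
qed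

lemma lucas_seq_ratio_tendsto:
  fixes \<alpha> \<beta> :: "'a::real_normed_field"
  assumes "norm \<beta> < norm \<alpha>"
  shows "(\<lambda>n. lucas_seq \<alpha> \<beta> (Suc n) / lucas_seq \<alpha> \<beta> n) \<longlonglongrightarrow> \<alpha>"
proof -
  define r where "r = \<beta> / \<alpha>"
  have nonzero: "\<alpha> \<noteq> 0" "\<alpha> - \<beta> \<noteq> 0"
    using assms by auto
  then have "norm r < 1"
    using assms by (simp add: r_def norm_divide)
  then have "(\<lambda>n. r ^ n) \<longlonglongrightarrow> 0"
    by (rule LIMSEQ_power_zero)
  then have "(\<lambda>n. (\<alpha> - \<beta> * r ^ n) / (1 - r ^ n)) \<longlonglongrightarrow> (\<alpha> - \<beta> * 0) / (1 - 0)"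
    by (intro tendsto_diff tendsto_divide tendsto_mult tendsto_const) simp_all
  moreover have "lucas_seq \<alpha> \<beta> (Suc n) / lucas_seq \<alpha> \<beta> n = (\<alpha> - \<beta> * r ^ n) / (1 - r ^ n)" for n
  proof -
    have power_\<beta>: "\<beta> ^ n = \<alpha> ^ n * r ^ n"
      using nonzero by (simp add: r_def power_divide)
    have "lucas_seq \<alpha> \<beta> (Suc n) / lucas_seq \<alpha> \<beta> n = (\<alpha> ^ Suc n - \<beta> ^ Suc n) / (\<alpha> ^ n - \<beta> ^ n)"
      using nonzero by (simp add: lucas_seq_def)
    also have "\<dots> = (\<alpha> ^ n * (\<alpha> - \<beta> * r ^ n)) / (\<alpha> ^ n * (1 - r ^ n))"
      by (simp add: power_\<beta> algebra_simps)
    also have "\<dots> = (\<alpha> - \<beta> * r ^ n) / (1 - r ^ n)"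
      using nonzero by simp
    finally show ?thesis .
  qed
  ultimately show ?thesis
    by simp
qed

definition alternating :: "'a \<Rightarrow> 'a \<Rightarrow> nat \<Rightarrow> 'a"
  where "alternating x y i = (if even i then x else y)"

lemma continuant_alternating:
  fixes \<alpha> \<beta> d :: "'a::field"
  assumes "\<alpha> \<noteq> \<beta>" "d \<noteq> 0" and d: "d = - (\<alpha> * \<beta>)"
  shows "continuant (\<lambda>i. alternating (\<alpha> + \<beta>) ((\<alpha> + \<beta>) / d) (r + i)) k
    = lucas_seq \<alpha> \<beta> (Suc k) * d ^ (r div 2) / d ^ ((r + k) div 2)"
proof (rule continuant_eqI[symmetric])
  show "lucas_seq \<alpha> \<beta> (Suc 0) * d ^ (r div 2) / d ^ ((r + 0) div 2) = 1"
    using assms by (simp add: lucas_seq_1)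
next
  have "lucas_seq \<alpha> \<beta> (Suc 1) = \<alpha> + \<beta>"
    using assms(1) by (simp add: lucas_seq_Suc_Suc lucas_seq_1 lucas_seq_0)
  then show "lucas_seq \<alpha> \<beta> (Suc 1) * d ^ (r div 2) / d ^ ((r + 1) div 2)
      = alternating (\<alpha> + \<beta>) ((\<alpha> + \<beta>) / d) (r + 0)"
    using assms(2) by (simp add: alternating_def)
next
  fix k
  let ?e = "(r + k) div 2"
  have exponent: "(r + Suc (Suc k)) div 2 = Suc ?e"
    by simp
  have rec: "lucas_seq \<alpha> \<beta> (Suc (Suc (Suc k)))
      = (\<alpha> + \<beta>) * lucas_seq \<alpha> \<beta> (Suc (Suc k)) + d * lucas_seq \<alpha> \<beta> (Suc k)"
    by (simp add: lucas_seq_Suc_Suc[of \<alpha> \<beta> "Suc k"] d)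
  show "lucas_seq \<alpha> \<beta> (Suc (Suc (Suc k))) * d ^ (r div 2) / d ^ ((r + Suc (Suc k)) div 2)
      = alternating (\<alpha> + \<beta>) ((\<alpha> + \<beta>) / d) (r + Suc k)
          * (lucas_seq \<alpha> \<beta> (Suc (Suc k)) * d ^ (r div 2) / d ^ ((r + Suc k) div 2))
        + lucas_seq \<alpha> \<beta> (Suc k) * d ^ (r div 2) / d ^ ?e"
  proof (cases "even (r + k)")
    case True
    then have "(r + Suc k) div 2 = ?e"
      by simp
    then show ?thesis
      unfolding exponent rec using True assms(2) by (simp add: alternating_def field_simps)
  next
    case False
    then have "(r + Suc k) div 2 = Suc ?e"
      by simp
    then show ?thesis
      unfolding exponent rec using False assms(2) by (simp add: alternating_def field_simps)
  qed
qed

lemma has_cfrac_alternating: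
  fixes \<alpha> \<beta> :: real
  assumes "\<bar>\<beta>\<bar> < \<bar>\<alpha>\<bar>" "\<beta> \<noteq> 0"
  shows "has_cfrac \<alpha> (alternating (\<alpha> + \<beta>) ((\<alpha> + \<beta>) / - (\<alpha> * \<beta>)))"
proof -
  define d where "d = - (\<alpha> * \<beta>)"
  let ?a = "alternating (\<alpha> + \<beta>) ((\<alpha> + \<beta>) / d)"
  have "\<alpha> \<noteq> \<beta>" and d: "d \<noteq> 0"
    using assms by (auto simp: d_def)
  note continuants = continuant_alternating[OF this d_def]
  have nonzero: "lucas_seq \<alpha> \<beta> (Suc k) \<noteq> 0" for k
    using assms(1) by (intro lucas_seq_nonzero) simp_all
  have defined: "cfrac_defined k ?a" for k
    using nonzero d by (intro cfrac_definedI) (simp add: continuants)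
  have "cfrac_fin k ?a = lucas_seq \<alpha> \<beta> (Suc (Suc k)) / lucas_seq \<alpha> \<beta> (Suc k)" for k
    using continuants[of 0 "Suc k"] continuants[of 1 k] d
    by (simp add: cfrac_fin_eq_continuant_ratio(2)[OF defined])
  moreover have "(\<lambda>k. lucas_seq \<alpha> \<beta> (Suc (Suc k)) / lucas_seq \<alpha> \<beta> (Suc k)) \<longlonglongrightarrow> \<alpha>"
    using assms(1) lucas_seq_ratio_tendsto[of \<beta> \<alpha>] by (intro LIMSEQ_Suc) simp_all
  ultimately show ?thesis
    using defined by (simp add: has_cfrac_def d_def)
qed

lemma periodic2_eq_alternating: "periodic2 a0 b1 b2 = (alternating b2 b1)(0 := a0)"
  by (auto simp: periodic2_def alternating_def)

lemma periodic2_eqI: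
  assumes "a 0 = a0"
    and "\<And>k. k \<ge> 1 \<Longrightarrow> a (2 * k - 1) = b1" "\<And>k. k \<ge> 1 \<Longrightarrow> a (2 * k) = b2"
  shows "a = periodic2 a0 b1 b2"
proof
  fix i :: nat
  show "a i = periodic2 a0 b1 b2 i"
  proof (cases "even i")
    case True
    then obtain k where "i = 2 * k" ..
    then show ?thesis
      using assms(1) assms(3)[of k] by (cases "k = 0") (simp_all add: periodic2_def)
  next
    case False
    then obtain k where "i = 2 * k + 1"
      by (elim oddE)
    then show ?thesis
      using assms(2)[of "k + 1"] by (simp add: periodic2_def)
  qed
qed

lemma has_cfrac_sqrt:
  fixes m x :: real
  assumes "0 < m" "0 < x" "x \<noteq> m\<^sup>2"
  shows "has_cfrac (sqrt x) (periodic2 m (2 * m / (x - m\<^sup>2)) (2 * m))"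
proof -
  let ?\<alpha> = "m + sqrt x" and ?\<beta> = "m - sqrt x"
  have "0 < sqrt x" "?\<beta> \<noteq> 0"
    using assms by auto
  then have "\<bar>?\<beta>\<bar> < \<bar>?\<alpha>\<bar>" "?\<beta> \<noteq> 0"
    using assms(1) by linarith+
  then have "has_cfrac ?\<alpha> (alternating (?\<alpha> + ?\<beta>) ((?\<alpha> + ?\<beta>) / - (?\<alpha> * ?\<beta>)))"
    by (rule has_cfrac_alternating)
  moreover have "?\<alpha> + ?\<beta> = 2 * m" "- (?\<alpha> * ?\<beta>) = x - m\<^sup>2"
    using assms(2) by (simp_all add: algebra_simps power2_eq_square)
  ultimately have "has_cfrac ?\<alpha> (alternating (2 * m) (2 * m / (x - m\<^sup>2)))"
    by (simp only:)
  from has_cfrac_add_first[OF this, of "- m"] show ?thesis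
    by (simp add: periodic2_eq_alternating alternating_def)
qed

lemma XB_Suc_square: "(XB (Suc j))\<^sup>2 = 2 + XB j"
proof -
  have "0 \<le> 2 + XB j"
    using cos_ge_minus_one[of "2 * pi / 2 ^ (j + 2)"] unfolding XB_def by linarith
  then show ?thesis
    by (simp add: XB_Suc)
qed

lemma BF_Rats:
  assumes "x \<in> \<rat>"
  shows "x \<in> BF i"
  unfolding BF_def using assms by (intro generate_field.incl) simp

lemma BF_add:
  assumes "x \<in> BF i" "y \<in> BF i"
  shows "x + y \<in> BF i"
  using assms generate_field.eng_add[of x real_field _ y]
  by (simp add: BF_def ring_of_type_algebra_def)

lemma BF_mult:
  assumes "x \<in> BF i" "y \<in> BF i"
  shows "x * y \<in> BF i"
  using assms generate_field.eng_mult[of x real_field _ y]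
  by (simp add: BF_def ring_of_type_algebra_def)

lemma XB_mem_BF:
  assumes "j \<le> i"
  shows "XB j \<in> BF i"
  using assms
proof (induction rule: inc_induct)
  case base
  show ?case
    unfolding BF_def by (intro generate_field.incl) simp
next
  case (step j)
  have "XB (Suc j) * XB (Suc j) + (-2) \<in> BF i"
    by (intro BF_add BF_mult step.IH BF_Rats) simp
  then show ?case
    using XB_Suc_square[of j] by (simp add: power2_eq_square)
qed

lemma Gal_fixes:
  assumes "\<sigma> \<in> carrier (Gal L K)" "x \<in> K"
  shows "\<sigma> x = x"
  using assms by (simp add: Gal_def)

lemma Gal_add:
  assumes "\<sigma> \<in> carrier (Gal L K)" "x \<in> L" "y \<in> L"
  shows "\<sigma> (x + y) = \<sigma> x + \<sigma> y"
  using assms ring_hom_add[of \<sigma> "real_field\<lparr>carrier := L\<rparr>" "real_field\<lparr>carrier := L\<rparr>" x y]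
  by (simp add: Gal_def ring_iso_def ring_of_type_algebra_def)

lemma Gal_mult:
  assumes "\<sigma> \<in> carrier (Gal L K)" "x \<in> L" "y \<in> L"
  shows "\<sigma> (x * y) = \<sigma> x * \<sigma> y"
  using assms ring_hom_mult[of \<sigma> "real_field\<lparr>carrier := L\<rparr>" "real_field\<lparr>carrier := L\<rparr>" x y]
  by (simp add: Gal_def ring_iso_def ring_of_type_algebra_def)

lemma GB_XB_Suc_square:
  assumes \<tau>: "\<tau> \<in> carrier (GB i)" and "Suc j \<le> i"
  shows "(\<tau> (XB (Suc j)))\<^sup>2 = 2 + \<tau> (XB j)"
proof -
  have \<tau>_Gal: "\<tau> \<in> carrier (Gal (BF i) \<rat>)"
    using \<tau> by (simp add: GB_def)
  have XB_mem: "XB (Suc j) \<in> BF i" "XB j \<in> BF i"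
    using assms(2) by (simp_all add: XB_mem_BF)
  have "(\<tau> (XB (Suc j)))\<^sup>2 = \<tau> (XB (Suc j) * XB (Suc j))"
    using XB_mem by (simp add: Gal_mult[OF \<tau>_Gal] power2_eq_square)
  also have "\<dots> = \<tau> (2 + XB j)"
    by (simp add: XB_Suc_square flip: power2_eq_square)
  also have "\<dots> = 2 + \<tau> (XB j)"
    using XB_mem by (simp add: Gal_add[OF \<tau>_Gal] BF_Rats Gal_fixes[OF \<tau>_Gal])
  finally show ?thesis .
qed

lemma GB_XB_bounds:
  assumes \<tau>: "\<tau> \<in> carrier (GB i)" and "j \<le> i"
  shows "\<bar>\<tau> (XB j)\<bar> < 2 \<and> \<tau> (XB j) \<noteq> -1"
  using assms(2)
proof (induction j)
  case 0
  have "\<tau> (XB 0) = 0"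
    using \<tau> Gal_fixes[of \<tau> "BF i" \<rat> 0] by (simp add: GB_def XB_0)
  then show ?case
    by simp
next
  case (Suc j)
  have IH: "\<bar>\<tau> (XB j)\<bar> < 2" "\<tau> (XB j) \<noteq> -1"
    using Suc by simp_all
  have square: "(\<tau> (XB (Suc j)))\<^sup>2 = 2 + \<tau> (XB j)"
    using \<tau> Suc.prems by (rule GB_XB_Suc_square)
  with IH(1) have "\<bar>\<tau> (XB (Suc j))\<bar>\<^sup>2 < 2\<^sup>2"
    by simp
  then have "\<bar>\<tau> (XB (Suc j))\<bar> < 2"
    by (rule power_less_imp_less_base) simp
  moreover have "\<tau> (XB (Suc j)) \<noteq> -1"
    using square IH(2) by auto
  ultimately show ?case ..
qed

theorem theorem3p3:
  fixes n :: nat and \<tau> :: "real \<Rightarrow> real" and c :: real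
    and a :: "nat \<Rightarrow> real" and p q :: "int \<Rightarrow> real"
  assumes "n \<ge> 1"
    and "\<tau> \<in> carrier (GB (n - 1))"
    and "c = 2 * inverse (1 + \<tau> (XB (n - 1)))"
    and "a 0 = 1"
    and "\<And>k. k \<ge> 1 \<Longrightarrow> a (2 * k - 1) = c"
    and "\<And>k. k \<ge> 1 \<Longrightarrow> a (2 * k) = 2"
    and "p (-1) = 1" and "p 0 = a 0"
    and "q (-1) = 0" and "q 0 = 1"
    and "\<And>k::nat. k \<ge> 1 \<Longrightarrow> p (int k) = a k * p (int k - 1) + p (int k - 2)"
    and "\<And>k::nat. k \<ge> 1 \<Longrightarrow> q (int k) = a k * q (int k - 1) + q (int k - 2)"
  shows "(\<forall>k::nat. q (int k) \<noteq> 0)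
    \<and> convergent (\<lambda>k::nat. p (int k) / q (int k))
    \<and> sqrt (2 + \<tau> (XB (n - 1))) = lim (\<lambda>k::nat. p (int k) / q (int k))
    \<and> has_cfrac (lim (\<lambda>k::nat. p (int k) / q (int k)))
        (periodic2 1 (2 * inverse (1 + \<tau> (XB (n - 1)))) 2)"
proof -
  define t where "t = \<tau> (XB (n - 1))"
  have t_bounds: "\<bar>t\<bar> < 2" "t \<noteq> -1"
    unfolding t_def using GB_XB_bounds[OF assms(2)] by auto
  have c_eq: "c = 2 / (2 + t - 1\<^sup>2)"
    using assms(3) by (simp add: t_def divide_inverse)
  have a_eq: "a = periodic2 1 c 2"
    using assms(4-6) by (rule periodic2_eqI)
  have cfrac: "has_cfrac (sqrt (2 + t)) a"
    unfolding a_eq c_eq using has_cfrac_sqrt[of 1 "2 + t"] t_bounds by simp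
  note convergents = has_cfrac_imp_convergents[OF cfrac assms(7-12)]
  have "lim (\<lambda>k. p (int k) / q (int k)) = sqrt (2 + t)"
    by (rule limI[OF convergents(2)])
  with convergents cfrac show ?thesis
    unfolding a_eq assms(3) t_def by (auto intro: convergentI)
qed

end
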